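(* Let $\lambda\in(0,1)$. Then for all $z\in\mathbb{C}$ with $z\notin\{0,-1,-2,\dots,\frac{1}{\lambda},\frac{1}{\lambda}+1,\frac{1}{\lambda}+2,\dots\}$, $$\Gamma_{\lambda}(z)=\frac{\lambda^{-z}}{\Gamma(\frac{1}{\lambda})}\lim_{n\to\infty}\frac{n^{\frac{1}{\lambda}}\,((n-1)!)^2}{z(1+z)\cdots(n-1+z)\left(\frac{1}{\lambda}-z\right)\left(1+\frac{1}{\lambda}-z\right)\cdots\left(n-1+\frac{1}{\lambda}-z\right)}.$$
   Context: For $\lambda\in(0,1)$ the degenerate gamma function is defined for $0<\operatorname{Re}(s)<\frac1\lambda$ by $\Gamma_{\lambda}(s)=\int_0^\infty (1+\lambda t)^{-\frac{1}{\lambda}}t^{s-1}dt$; it extends to a meromorphic function on $\mathbb{C}$ given by $\Gamma_\lambda(s)=\lambda^{-s}\Gamma(s)\Gamma(\frac1\lambda-s)/\Gamma(\frac1\lambda)$, where $\Gamma$ is the usual gamma function. $\Gamma_\lambda$ denotes this continuation. *)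

theory Defs
  imports "HOL-Complex_Analysis.Complex_Analysis"
begin

text \<open>
  The integral converges absolutely for \<open>0 < Re s < 1 / lam\<close>; outside this strip the value
  of the Lebesgue integral is not used.
\<close>

definition degenerate_Gamma_integral :: "real \<Rightarrow> complex \<Rightarrow> complex" where
  "degenerate_Gamma_integral lam s =
     (LINT t:{0<..}|lborel.
        complex_of_real ((1 + lam * t) powr (- 1 / lam)) * complex_of_real t powr (s - 1))"

text \<open>
  The meromorphic continuation of the integral to the whole plane. The predicate
  \<open>nicely_meromorphic_on\<close> (rather than \<open>meromorphic_on\<close>) fixes the values of the total function:
  it is continuous wherever it has no pole, and it is \<open>0\<close> at its poles, which is also the
  convention of \<^const>\<open>Gamma\<close>. By the identity theorem there is at most one such function. For
  \<open>0 < lam < 1\<close> it exists, namely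
  \<open>s \<mapsto> lam powr (- s) * Gamma s * Gamma (1 / lam - s) / Gamma (1 / lam)\<close>.
\<close>

definition degenerate_Gamma :: "real \<Rightarrow> complex \<Rightarrow> complex" where
  "degenerate_Gamma lam =
     (THE G. G nicely_meromorphic_on UNIV \<and>
        (\<forall>s. 0 < Re s \<and> Re s < 1 / lam \<longrightarrow> G s = degenerate_Gamma_integral lam s))"

end

theory Submission
  imports Defs
begin

text \<open>
  On the strip, Fubini evaluates the integral in terms of \<^const>\<open>Gamma\<close>. The resulting closed
  form is the reciprocal of an entire function, hence nicely meromorphic, and by the identity
  theorem it is the continuation. The limit is the product of Euler's limits for \<open>Gamma z\<close> and
  \<open>Gamma (1 / lam - z)\<close>, whose factors \<open>n powr z\<close> and \<open>n powr (1 / lam - z)\<close> combine to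
  \<open>n powr (1 / lam)\<close>.
\<close>

text \<open>Gives the uniqueness behind the \<open>THE\<close> in \<open>degenerate_Gamma\<close>.
  The identity theorem makes \<open>f\<close> and \<open>g\<close> agree on a punctured
  neighbourhood of every point. At the point itself both vanish if it is a pole, and otherwise both
  equal their common limit.\<close>

lemma nicely_meromorphic_on_UNIV_eqI:
  assumes f: "f nicely_meromorphic_on UNIV" and g: "g nicely_meromorphic_on UNIV"
    and U: "open U" "U \<noteq> {}" "\<And>z. z \<in> U \<Longrightarrow> f z = g z"
  shows "f = g"
proof
  fix z
  \<comment> \<open>At a common pole the pointwise difference is \<open>0 - 0\<close>, which need
    not be its limit there; \<open>remove_sings\<close> repairs such values.\<close>
  define d where "d = remove_sings (\<lambda>z. f z - g z)"
  have fm: "f meromorphic_on UNIV" and gm: "g meromorphic_on UNIV"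
    using f g by (auto simp: nicely_meromorphic_on_def)
  have dm: "(\<lambda>z. f z - g z) meromorphic_on UNIV"
    by (intro meromorphic_intros fm gm)
  have d: "d nicely_meromorphic_on UNIV"
    unfolding d_def by (rule remove_sings_nicely_meromorphic[OF dm])
  have ev_d: "\<forall>\<^sub>F w in at x. d w = f w - g w" for x
    unfolding d_def
    by (rule eventually_remove_sings_eq_at)
       (use dm in \<open>auto intro: meromorphic_on_isolated_singularity meromorphic_on_subset\<close>)
  obtain z0 where z0: "z0 \<in> U" using U by auto
  have "\<forall>\<^sub>F w in at z0. w \<in> U"
    using U z0 by (intro eventually_at_in_open') auto
  with ev_d[of z0] have "\<forall>\<^sub>F w in at z0. d w = 0"
    by eventually_elim (use U in auto)
  hence fr: "\<exists>\<^sub>F w in at z0. d w = 0"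
    by (intro eventually_frequently) auto
  have d0: "d w = 0" for w
    by (rule frequently_eq_meromorphic_imp_constant[OF fr d]) auto
  have ev: "\<forall>\<^sub>F w in at z. f w = g w"
    using ev_d[of z] by eventually_elim (use d0 in auto)
  hence pole: "is_pole f z \<longleftrightarrow> is_pole g z"
    by (intro is_pole_cong) auto
  show "f z = g z"
  proof (cases "is_pole f z")
    case True
    thus ?thesis
      using pole is_pole_zero_at_nicely_mero[OF f] is_pole_zero_at_nicely_mero[OF g] by simp
  next
    case False
    hence "f \<midarrow>z\<rightarrow> f z" and "g \<midarrow>z\<rightarrow> g z"
      using f g pole by (auto simp: nicely_meromorphic_on_def)
    moreover have "f \<midarrow>z\<rightarrow> g z \<longleftrightarrow> g \<midarrow>z\<rightarrow> g z"
      by (rule tendsto_cong[OF ev])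
    ultimately show ?thesis
      using tendsto_unique[of "at z" f] by auto
  qed
qed

text \<open>The integrand of Euler's integral with decay rate \<open>c\<close>, extended by 0 to the
  whole line. Both iterated integrals in the Fubini argument reduce to this one family.\<close>

definition Gamma_kernel :: "complex \<Rightarrow> real \<Rightarrow> real \<Rightarrow> complex" where
  "Gamma_kernel w c t =
     indicator {0<..} t *\<^sub>R (of_real t powr (w - 1) * of_real (exp (- (c * t))))"

lemma Gamma_kernel_nonpos [simp]: "t \<le> 0 \<Longrightarrow> Gamma_kernel w c t = 0"
  by (simp add: Gamma_kernel_def)

lemma Gamma_kernel_pos:
  "t > 0 \<Longrightarrow> Gamma_kernel w c t = of_real t powr (w - 1) * of_real (exp (- (c * t)))"
  by (simp add: Gamma_kernel_def)

text \<open>With the real \<open>ln\<close> in place of the complex power, measurability is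
  automatic and products of kernels simplify by the laws of \<open>exp\<close>.\<close>

lemma Gamma_kernel_altdef:
  "Gamma_kernel w c t =
     indicator {0<..} t *\<^sub>R (exp ((w - 1) * of_real (ln t)) * of_real (exp (- (c * t))))"
  by (auto simp: Gamma_kernel_def powr_def Ln_of_real indicator_def)

lemma borel_measurable_Gamma_kernel [measurable]:
  assumes [measurable]: "c \<in> borel_measurable M" "t \<in> borel_measurable M"
  shows "(\<lambda>x. Gamma_kernel w (c x) (t x)) \<in> borel_measurable M"
  unfolding Gamma_kernel_altdef by measurable

lemma has_bochner_integral_Gamma_kernel_1:
  assumes "Re w > 0"
  shows "has_bochner_integral lborel (Gamma_kernel w 1) (Gamma w)"
proof -
  let ?f = "\<lambda>t. complex_of_real t powr (w - 1) / of_real (exp t)"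
  have eq: "Gamma_kernel w 1 = (\<lambda>t. indicator {0<..} t *\<^sub>R ?f t)"
    by (auto simp: fun_eq_iff Gamma_kernel_def exp_minus field_simps)
  have abs: "?f absolutely_integrable_on {0<..}"
    by (rule absolutely_integrable_Gamma_integral'[OF assms])
  have "integrable lebesgue (Gamma_kernel w 1)"
    using abs by (simp add: set_integrable_def eq)
  \<comment> \<open>The kernel is Borel measurable, so integrability passes from the completed
    measure to \<open>lborel\<close>.\<close>
  hence int: "integrable lborel (Gamma_kernel w 1)"
    by (subst (asm) integrable_completion) auto
  have "set_integrable lborel {0<..} ?f"
    using int by (simp add: set_integrable_def eq)
  hence "(LINT t:{0<..}|lborel. ?f t) = integral {0<..} ?f"
    by (rule set_borel_integral_eq_integral)
  also have "\<dots> = Gamma w"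
    using Gamma_integral_complex'[OF assms] by (rule integral_unique)
  finally show ?thesis
    using int by (simp add: has_bochner_integral_iff eq set_lebesgue_integral_def)
qed

text \<open>Substitute \<open>c * t\<close> for \<open>t\<close>: the Jacobian contributes
  \<open>1 / c\<close> and the power contributes \<open>c powr (1 - w)\<close>.\<close>

lemma has_bochner_integral_Gamma_kernel:
  assumes "Re w > 0" "c > 0"
  shows "has_bochner_integral lborel (Gamma_kernel w c) (of_real c powr (- w) * Gamma w)"
proof -
  have "has_bochner_integral lborel (\<lambda>t. Gamma_kernel w 1 (0 + c * t)) (Gamma w /\<^sub>R \<bar>c\<bar>)"
    using has_bochner_integral_Gamma_kernel_1[OF assms(1)] assms(2)
    by (subst (asm) lborel_has_bochner_integral_real_affine_iff[of c _ _ 0]) auto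
  hence "has_bochner_integral lborel
      (\<lambda>t. of_real c powr (1 - w) * Gamma_kernel w 1 (0 + c * t))
      (of_real c powr (1 - w) * (Gamma w /\<^sub>R \<bar>c\<bar>))"
    by (intro has_bochner_integral_mult_right) auto
  also have "(\<lambda>t. of_real c powr (1 - w) * Gamma_kernel w 1 (0 + c * t)) = Gamma_kernel w c"
  proof
    fix t
    show "of_real c powr (1 - w) * Gamma_kernel w 1 (0 + c * t) = Gamma_kernel w c t"
    proof (cases "t > 0")
      case True
      thus ?thesis using assms
        by (simp add: Gamma_kernel_altdef powr_def Ln_of_real ln_mult ring_distribs
              exp_add exp_diff exp_minus field_simps)
    next
      case False
      thus ?thesis using assms by (simp add: mult_nonneg_nonpos)
    qed
  qed
  also have "of_real c powr (1 - w) * (Gamma w /\<^sub>R \<bar>c\<bar>) = of_real c powr (- w) * Gamma w"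
    using assms by (simp add: powr_diff powr_minus scaleR_conv_of_real field_simps)
  finally show ?thesis .
qed

text \<open>The family is closed under norms, so the same integral formula also yields the absolute
  integrability required by Fubini.\<close>

lemma norm_Gamma_kernel: "of_real (norm (Gamma_kernel w c t)) = Gamma_kernel (of_real (Re w)) c t"
  by (cases "t > 0")
     (auto simp: Gamma_kernel_altdef norm_mult exp_of_real[symmetric] simp del: exp_of_real)

text \<open>
  With \<open>a = 1 / lam\<close>, Fubini is applied to
  \<open>u powr (a - 1) * exp (- u) * t powr (s - 1) * exp (- lam * u * t)\<close>: integrating over \<open>t\<close>
  first gives \<open>lam powr (- s) * Gamma s * Gamma (a - s)\<close>, and over \<open>u\<close> first gives \<open>Gamma a\<close>
  times the degenerate Gamma integral.
\<close>

lemma degenerate_Gamma_integral_eq: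
  assumes lam: "0 < lam" and s: "0 < Re s" "Re s < 1 / lam"
  shows "degenerate_Gamma_integral lam s =
    of_real lam powr (- s) * Gamma s * Gamma (of_real (1 / lam) - s) / Gamma (of_real (1 / lam))"
proof -
  define a where "a = complex_of_real (1 / lam)"
  define F where "F = (\<lambda>(u, t). Gamma_kernel a 1 u * Gamma_kernel s (lam * u) t)"
  have a: "Re a > 0" "Re (a - s) > 0" using lam s by (auto simp: a_def)
  \<comment> \<open>The factor \<open>u powr (- w)\<close> left by the integration over
    \<open>t\<close> lowers the exponent of the outer kernel from \<open>a\<close> to
    \<open>a - w\<close>. It is needed for \<open>w = s\<close> and, for the norms, for
    \<open>w = Re s\<close>.\<close>
  have inner_t: "Gamma_kernel a 1 u * (of_real (lam * u) powr (- w)) =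
      of_real lam powr (- w) * Gamma_kernel (a - w) 1 u" for u w
  proof (cases "u > 0")
    case True
    have "Ln (of_real lam * of_real u) = complex_of_real (ln lam) + of_real (ln u)"
      using Ln_of_real[of "lam * u"] lam True by (simp add: ln_mult)
    thus ?thesis using lam True
      by (simp add: Gamma_kernel_altdef powr_def Ln_of_real ring_distribs
            exp_add exp_diff exp_minus field_simps)
  qed simp
  have norm_int: "(LINT t|lborel. norm (F (u, t))) =
      norm (of_real lam powr (- of_real (Re s)) * Gamma (of_real (Re s) :: complex)) *
        norm (Gamma_kernel (a - of_real (Re s)) 1 u)" for u
  proof (cases "u > 0")
    case True
    have "complex_of_real (LINT t|lborel. norm (Gamma_kernel s (lam * u) t)) =
        of_real (lam * u) powr (- of_real (Re s)) * Gamma (of_real (Re s))"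
      using has_bochner_integral_Gamma_kernel[of "of_real (Re s)" "lam * u"] s lam True
      by (simp add: has_bochner_integral_iff norm_Gamma_kernel flip: integral_complex_of_real)
    hence "norm (complex_of_real (LINT t|lborel. norm (Gamma_kernel s (lam * u) t))) =
        norm (of_real (lam * u) powr (- of_real (Re s)) * Gamma (complex_of_real (Re s)))"
      by (rule arg_cong)
    hence "(LINT t|lborel. norm (Gamma_kernel s (lam * u) t)) =
        norm (of_real (lam * u) powr (- of_real (Re s)) * Gamma (complex_of_real (Re s)))"
      by (simp only: norm_of_real abs_of_nonneg Bochner_Integration.integral_nonneg norm_ge_zero)
    hence "(LINT t|lborel. norm (F (u, t))) =
        norm (Gamma_kernel a 1 u * (of_real (lam * u) powr (- of_real (Re s))))
           * norm (Gamma (complex_of_real (Re s)))"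
      by (simp add: F_def norm_mult)
    thus ?thesis
      by (subst (asm) inner_t) (simp add: norm_mult)
  qed (simp add: F_def)
  have Ft: "has_bochner_integral lborel (\<lambda>t. F (u, t))
      (of_real lam powr (- s) * Gamma s * Gamma_kernel (a - s) 1 u)" for u
  proof (cases "u > 0")
    case True
    have "has_bochner_integral lborel (\<lambda>t. F (u, t))
        (Gamma_kernel a 1 u * (of_real (lam * u) powr (- s) * Gamma s))"
      unfolding F_def prod.case using lam True s
      by (intro has_bochner_integral_mult_right has_bochner_integral_Gamma_kernel) auto
    thus ?thesis using inner_t[of u s] by (simp add: mult_ac)
  qed (simp add: F_def has_bochner_integral_zero)
  have Fu: "has_bochner_integral lborel (\<lambda>u. F (u, t))
      (indicator {0<..} t *\<^sub>R (of_real ((1 + lam * t) powr (- 1 / lam)) * of_real t powr (s - 1))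
        * Gamma a)" for t
  proof (cases "t > 0")
    case True
    have pos: "1 + lam * t > 0" using lam True by (simp add: add_pos_pos)
    \<comment> \<open>The two exponentials merge into decay rate \<open>1 + lam * t\<close>, whose
      power \<open>- a\<close> is the degenerate exponential of the integrand.\<close>
    have "(\<lambda>u. F (u, t)) = (\<lambda>u. of_real t powr (s - 1) * Gamma_kernel a (1 + lam * t) u)"
      using True
      by (auto simp: F_def Gamma_kernel_def fun_eq_iff indicator_def ring_distribs exp_add
            exp_diff exp_minus field_simps)
    moreover have "complex_of_real ((1 + lam * t) powr (- 1 / lam)) = of_real (1 + lam * t) powr (- a)"
      using powr_of_real[of "1 + lam * t" "- 1 / lam"] pos by (simp add: a_def)
    moreover have "has_bochner_integral lborel
        (\<lambda>u. of_real t powr (s - 1) * Gamma_kernel a (1 + lam * t) u)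
        (of_real t powr (s - 1) * (of_real (1 + lam * t) powr (- a) * Gamma a))"
      by (intro has_bochner_integral_mult_right has_bochner_integral_Gamma_kernel pos a)
    ultimately show ?thesis using True by (simp add: mult_ac)
  qed (simp add: F_def has_bochner_integral_zero)
  have [measurable]: "F \<in> borel_measurable (lborel \<Otimes>\<^sub>M lborel)"
    unfolding F_def by measurable
  have "integrable (lborel \<Otimes>\<^sub>M lborel) F"
  proof (rule lborel_pair.Fubini_integrable)
    show "integrable lborel (\<lambda>u. LINT t|lborel. norm (F (u, t)))"
      unfolding norm_int
      \<comment> \<open>The outer integral converges because \<open>Re s < 1 / lam\<close>.\<close>
      using has_bochner_integral_Gamma_kernel_1[of "a - of_real (Re s)"] a
      by (intro integrable_mult_right integrable_norm) (auto simp: has_bochner_integral_iff)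
  qed (use Ft in \<open>auto simp: has_bochner_integral_iff\<close>)
  hence "(LINT t|lborel. LINT u|lborel. F (u, t)) = (LINT u|lborel. LINT t|lborel. F (u, t))"
    using lborel_pair.Fubini_integral[of "curry F"] by simp
  also have "(LINT t|lborel. LINT u|lborel. F (u, t)) = degenerate_Gamma_integral lam s * Gamma a"
    using Fu unfolding has_bochner_integral_iff
    by (simp add: degenerate_Gamma_integral_def set_lebesgue_integral_def del: mult_scaleR_left)
  also have "(LINT u|lborel. LINT t|lborel. F (u, t)) =
      of_real lam powr (- s) * Gamma s * Gamma (a - s)"
    using Ft has_bochner_integral_Gamma_kernel_1[OF a(2)] unfolding has_bochner_integral_iff
    by simp
  finally have "degenerate_Gamma_integral lam s * Gamma a = \<dots>" .
  moreover have "Gamma a \<noteq> 0"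
    using a by (intro Gamma_nonzero) (auto elim!: nonpos_Ints_cases)
  ultimately show ?thesis
    unfolding a_def[symmetric] by (simp add: field_simps)
qed

lemma degenerate_Gamma_eq:
  assumes lam: "0 < lam"
  shows "degenerate_Gamma lam s =
    of_real lam powr (- s) * Gamma s * Gamma (of_real (1 / lam) - s) / Gamma (of_real (1 / lam))"
proof -
  define G where "G = (\<lambda>s. of_real lam powr (- s) * Gamma s * Gamma (of_real (1 / lam) - s)
    / Gamma (complex_of_real (1 / lam)))"
  \<comment> \<open>Entire, since \<open>rGamma\<close> is. As \<open>inverse 0 = 0\<close>, its
    reciprocal agrees with \<open>G\<close> at the poles too.\<close>
  define h where "h = (\<lambda>s. of_real lam powr s * rGamma s * rGamma (of_real (1 / lam) - s)
    * Gamma (complex_of_real (1 / lam)))"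
  have "h analytic_on UNIV"
    unfolding h_def using lam by (auto simp: analytic_on_open intro!: holomorphic_intros)
  hence "(\<lambda>s. inverse (h s)) nicely_meromorphic_on UNIV"
    by (intro nicely_meromorphic_on_inverse analytic_on_imp_nicely_meromorphic_on)
  also have "(\<lambda>s. inverse (h s)) = G"
    by (simp add: fun_eq_iff h_def G_def rGamma_inverse_Gamma powr_minus field_simps)
  finally have G: "G nicely_meromorphic_on UNIV" .
  have strip: "G s = degenerate_Gamma_integral lam s" if "0 < Re s" "Re s < 1 / lam" for s
    using degenerate_Gamma_integral_eq[OF lam that] by (simp add: G_def)
  define U where "U = {s. 0 < Re s \<and> Re s < 1 / lam}"
  have "open U"
    unfolding U_def by (intro open_Collect_conj open_halfspace_Re_gt open_halfspace_Re_lt)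
  \<comment> \<open>The midpoint of the real segment of the strip.\<close>
  moreover have "complex_of_real (1 / (2 * lam)) \<in> U"
    using lam by (simp add: U_def field_simps)
  hence "U \<noteq> {}" by blast
  ultimately have "degenerate_Gamma lam = G"
    unfolding degenerate_Gamma_def using G strip
    by (intro the_equality conjI nicely_meromorphic_on_UNIV_eqI[of _ G U]) (simp_all add: U_def)
  thus ?thesis by (simp add: G_def)
qed

theorem theorem2p5:
  fixes lam :: real and z :: complex
  assumes "0 < lam" and "lam < 1"
    and "z \<notin> {- of_nat k |k::nat. True} \<union> {complex_of_real (1 / lam) + of_nat k |k::nat. True}"
  defines "a \<equiv> (\<lambda>n::nat.
      complex_of_real (real n powr (1 / lam)) * (fact (n - 1))\<^sup>2
        / ((\<Prod>k<n. of_nat k + z) * (\<Prod>k<n. of_nat k + complex_of_real (1 / lam) - z)))"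
  shows "convergent a \<and>
    degenerate_Gamma lam z =
      complex_of_real lam powr (- z) / Gamma (complex_of_real (1 / lam)) * lim a"
proof -
  let ?w = "complex_of_real (1 / lam) - z"
  \<comment> \<open>The primed series has \<open>(n - 1)!\<close> over exactly \<open>n\<close>
    factors, as in the claimed limit.\<close>
  have "(\<lambda>n. Gamma_series' z n * Gamma_series' ?w n) \<longlonglongrightarrow> Gamma z * Gamma ?w"
    by (intro tendsto_mult Gamma_series'_LIMSEQ)
  moreover have "\<forall>\<^sub>F n in sequentially. Gamma_series' z n * Gamma_series' ?w n = a n"
    \<comment> \<open>At \<open>n = 0\<close> the terms differ: \<open>0 powr (1 / lam)\<close> is
      0, but an exponential never vanishes.\<close>
    using eventually_gt_at_top[of 0]
  proof eventually_elim
    case (elim n)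
    have "exp (z * of_real (ln (of_nat n))) * exp (?w * of_real (ln (of_nat n))) =
        exp (complex_of_real (1 / lam * ln (real n)))"
      by (simp flip: exp_add add: algebra_simps)
    also have "\<dots> = complex_of_real (real n powr (1 / lam))"
      using elim by (simp add: powr_def flip: exp_of_real)
    finally have e: "complex_of_real (real n powr (1 / lam)) =
      exp (z * of_real (ln (of_nat n))) * exp (?w * of_real (ln (of_nat n)))" ..
    have "pochhammer z n = (\<Prod>k<n. of_nat k + z)"
      "pochhammer ?w n = (\<Prod>k<n. of_nat k + complex_of_real (1 / lam) - z)"
      by (simp_all add: pochhammer_prod atLeast0LessThan add_ac diff_add_eq add_diff_eq)
    thus ?case
      unfolding a_def e by (simp add: Gamma_series'_def power2_eq_square)
  qed
  ultimately have lim: "a \<longlonglongrightarrow> Gamma z * Gamma ?w"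
    by (rule Lim_transform_eventually)
  thus ?thesis
    using degenerate_Gamma_eq[OF assms(1), of z] by (auto simp: convergent_def limI)
qed

end
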